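(* Let $L$ be a linear subspace of $\mathbb{R}^n$ and let $S\subseteq L$ be a convex set. Let $\mathcal{M}_S$ and $\mathcal{M}_L$ be the modeling approaches $$\mathcal{M}_S:\ \hat\mu^{y,S}=\operatorname*{arg\,min}_{\tilde\mu\in S}\frac1n\|\tilde\mu-y\|_2^2,\qquad \mathcal{M}_L:\ \hat\mu^{y,L}=\operatorname*{arg\,min}_{\tilde\mu\in L}\frac1n\|\tilde\mu-y\|_2^2 .$$ If the random data vector $y\in\mathbb{R}^n$ and the maps $y\mapsto\hat\mu^{y,S}$ and $y\mapsto\hat\mu^{y,L}$ are such that the conditions for Stein's lemma are satisfied for both $\mathcal{M}_S$ and $\mathcal{M}_L$, then $$\omega_S\le\omega_L .$$
   Context: A modeling approach is a map $\mathbb{R}^n\to\mathbb{R}^n$ from a training vector $y$ to a fitted model $\hat\mu$. The minimizer defining $\hat\mu^{y,S}$ is understood to exist for every $y\in\mathbb{R}^n$ (as $\mathcal{M}_S$ is a modeling approach), so $\hat\mu^{y,S}$ and $\hat\mu^{y,L}$ are the Euclidean projections of $y$ onto $S$ and $L$. The (expected) optimism of a modeling approach $\hat\mu$ is $$\omega=\frac1n\Bigl(\mathbb{E}\|\hat\mu(y)-y^{\mathrm{new}}\|_2^2-\mathbb{E}\|\hat\mu(y)-y\|_2^2\Bigr),$$ where $y^{\mathrm{new}}$ is independent of $y$ and has the same distribution as $y$. $\omega_S$ and $\omega_L$ denote the optimism of $\mathcal{M}_S$ and $\mathcal{M}_L$. "The conditions for Stein's lemma are satisfied" for a modeling approach $\hat\mu$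 means: $y\sim\mathcal{N}(\mu,\sigma^2I_{n\times n})$ for some $\mu\in\mathbb{R}^n$, $\sigma^2>0$, and $\hat\mu$, as a function of $y$, is regular enough (the partial derivatives $\partial\hat\mu_i/\partial y_i$ exist for almost every $y$ and are integrable) that Stein's identity holds: $$\omega=\frac{2\sigma^2}{n}\,\mathbb{E}\Bigl(\sum_{i=1}^n\frac{\partial\hat\mu_i}{\partial y_i}\Bigr).$$ *)

theory Defs
  imports "HOL-Probability.Probability"
begin

definition fitted_model :: "(real ^ 'n) set \<Rightarrow> real ^ 'n \<Rightarrow> real ^ 'n" where
  "fitted_model S y = arg_min_on (\<lambda>m. 1 / real CARD('n) * (norm (m - y))\<^sup>2) S"

(* arg_min_on is a choice operator, so that a minimizer exists for every training vector
   has to be required separately. *)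
definition is_modeling_approach :: "(real ^ 'n) set \<Rightarrow> bool" where
  "is_modeling_approach S \<longleftrightarrow>
     (\<forall>y. \<exists>m. is_arg_min (\<lambda>m. 1 / real CARD('n) * (norm (m - y))\<^sup>2) (\<lambda>m. m \<in> S) m)"

definition independent_copy ::
    "'a measure \<Rightarrow> ('a \<Rightarrow> real ^ 'n) \<Rightarrow> ('a \<Rightarrow> real ^ 'n) \<Rightarrow> bool" where
  "independent_copy M y ynew \<longleftrightarrow>
     prob_space.indep_var M borel y borel ynew \<and> distr M borel ynew = distr M borel y"

(* Meaningful when ynew is an independent copy of y. *)
definition optimism ::
    "'a measure \<Rightarrow> ('a \<Rightarrow> real ^ 'n) \<Rightarrow> ('a \<Rightarrow> real ^ 'n) \<Rightarrow> (real ^ 'n \<Rightarrow> real ^ 'n) \<Rightarrow> real" where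
  "optimism M y ynew muhat = 1 / real CARD('n) *
     ((\<integral>w. (norm (muhat (y w) - ynew w))\<^sup>2 \<partial>M) - (\<integral>w. (norm (muhat (y w) - y w))\<^sup>2 \<partial>M))"

(* The covariance matrix is sigma^2 times the identity, so the joint density is the product of
   the coordinate densities; sigma is the standard deviation. *)
definition isotropic_normal ::
    "'a measure \<Rightarrow> ('a \<Rightarrow> real ^ 'n) \<Rightarrow> real ^ 'n \<Rightarrow> real \<Rightarrow> bool" where
  "isotropic_normal M y \<mu> \<sigma> \<longleftrightarrow>
     0 < \<sigma> \<and> distributed M lborel y (\<lambda>x. ennreal (\<Prod>i\<in>UNIV. normal_density (\<mu> $ i) \<sigma> (x $ i)))"

(* The i-th component of muhat along the line through x in the i-th coordinate direction:
   its derivative at 0 is the partial derivative of muhat_i with respect to y_i at x. *)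
definition coord_slice :: "(real ^ 'n \<Rightarrow> real ^ 'n) \<Rightarrow> 'n \<Rightarrow> real ^ 'n \<Rightarrow> real \<Rightarrow> real" where
  "coord_slice muhat i x t = muhat (x + t *\<^sub>R axis i 1) $ i"

definition diag_partial :: "(real ^ 'n \<Rightarrow> real ^ 'n) \<Rightarrow> 'n \<Rightarrow> real ^ 'n \<Rightarrow> real" where
  "diag_partial muhat i x = deriv (coord_slice muhat i x) 0"

definition stein_conditions ::
    "'a measure \<Rightarrow> ('a \<Rightarrow> real ^ 'n) \<Rightarrow> ('a \<Rightarrow> real ^ 'n) \<Rightarrow> real ^ 'n \<Rightarrow> real \<Rightarrow>
     (real ^ 'n \<Rightarrow> real ^ 'n) \<Rightarrow> bool" where
  "stein_conditions M y ynew \<mu> \<sigma> muhat \<longleftrightarrow>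
     isotropic_normal M y \<mu> \<sigma> \<and>
     (AE x in lborel. \<forall>i. coord_slice muhat i x field_differentiable at 0) \<and>
     (\<forall>i. integrable M (\<lambda>w. diag_partial muhat i (y w))) \<and>
     optimism M y ynew muhat =
       2 * \<sigma>\<^sup>2 / real CARD('n) * (\<integral>w. (\<Sum>i\<in>UNIV. diag_partial muhat i (y w)) \<partial>M)"

end

theory Submission imports Defs begin

text \<open>
  Independence of \<open>ynew\<close> from \<open>y\<close> and equality of their distributions turn the optimism of any
  square-integrable procedure \<open>f\<close> into a covariance,
  \<open>\<omega> = (2/n) E \<langle>f(y) - c, y - E y\<rangle>\<close>,
  where the constant vector \<open>c\<close> is arbitrary (lemma \<open>optimism_eq_covariance\<close>). The formula is used
  with \<open>f\<close> the projection onto \<open>S\<close> or \<open>L\<close> and \<open>c = f(E y)\<close>, because then the two integrands can be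
  compared for each outcome separately.

  Put \<open>m = E y\<close>, and let \<open>d = P\<^sub>S y - P\<^sub>S m\<close> and \<open>e = P\<^sub>L y - P\<^sub>L m\<close>.
  Projections onto convex sets are firmly nonexpansive, so \<open>\<parallel>d\<parallel>\<^sup>2 \<le> \<langle>d, y - m\<rangle>\<close>.
  Both \<open>d\<close> and \<open>e\<close> lie in \<open>L\<close>, while \<open>y - m - e\<close> is orthogonal to \<open>L\<close>, so
  \<open>\<langle>d, y - m\<rangle> = \<langle>d, e\<rangle>\<close> and \<open>\<langle>e, y - m\<rangle> = \<parallel>e\<parallel>\<^sup>2\<close>. Hence
  \<open>2\<langle>d, e\<rangle> \<le> \<parallel>d\<parallel>\<^sup>2 + \<parallel>e\<parallel>\<^sup>2 \<le> \<langle>d, e\<rangle> + \<parallel>e\<parallel>\<^sup>2\<close>, that is,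
  \<open>\<langle>d, y - m\<rangle> \<le> \<langle>e, y - m\<rangle>\<close> (lemma \<open>closest_point_subspace_dominates\<close>).
  Taking expectations gives the result. Normality of \<open>y\<close> enters through its finite second moments.
\<close>

section \<open>Projections onto convex sets\<close>

text \<open>A limit point of \<open>S\<close> is at distance zero from its own minimizer, hence equal to it.\<close>

lemma is_modeling_approach_closed:
  fixes S :: "(real ^ 'n) set"
  assumes "is_modeling_approach S"
  shows "closed S" "S \<noteq> {}"
proof -
  have ex: "\<exists>m\<in>S. \<forall>x\<in>S. norm (m - y) \<le> norm (x - y)" for y
  proof -
    obtain m where "m \<in> S"
      "\<forall>x\<in>S. 1 / real CARD('n) * (norm (m - y))\<^sup>2 \<le> 1 / real CARD('n) * (norm (x - y))\<^sup>2"
      using assms unfolding is_modeling_approach_def is_arg_min_linorder by blast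
    then show ?thesis by (auto simp: divide_simps intro!: bexI[of _ m])
  qed
  then show "S \<noteq> {}" by blast
  have "y \<in> S" if "y \<in> closure S" for y
  proof -
    obtain m where m: "m \<in> S" "\<forall>x\<in>S. norm (m - y) \<le> norm (x - y)" using ex by blast
    have "norm (m - y) \<le> 0 + e" if "e > 0" for e
      using \<open>y \<in> closure S\<close> that m(2) unfolding closure_approachable dist_norm by fastforce
    then have "norm (m - y) \<le> 0" by (rule field_le_epsilon)
    with m(1) show ?thesis by simp
  qed
  then show "closed S" using closure_subset_eq by blast
qed

lemma fitted_model_eq_closest_point:
  fixes S :: "(real ^ 'n) set"
  assumes "closed S" "convex S" "S \<noteq> {}"
  shows "fitted_model S = closest_point S"
proof
  fix y :: "real ^ 'n"
  let ?f = "\<lambda>m. 1 / real CARD('n) * (norm (m - y))\<^sup>2"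
  have "is_arg_min ?f (\<lambda>m. m \<in> S) (closest_point S y)"
    unfolding is_arg_min_linorder
    using closest_point_in_set[OF assms(1,3)] closest_point_le[OF assms(1), of _ y]
    by (auto simp: divide_simps dist_norm norm_minus_commute)
  then have "is_arg_min ?f (\<lambda>m. m \<in> S) (fitted_model S y)"
    unfolding fitted_model_def arg_min_on_def arg_min_def by (rule someI)
  then have "fitted_model S y \<in> S" "\<forall>z\<in>S. dist y (fitted_model S y) \<le> dist y z"
    unfolding is_arg_min_linorder by (auto simp: divide_simps dist_norm norm_minus_commute)
  then show "fitted_model S y = closest_point S y"
    by (rule closest_point_unique[OF assms(2,1)])
qed

text \<open>Add the variational inequalities of the two projections, each tested at the other one.\<close>

lemma closest_point_firmly_nonexpansive:
  fixes S :: "'a::euclidean_space set"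
  assumes "convex S" "closed S" "S \<noteq> {}"
  defines "P \<equiv> closest_point S"
  shows "(norm (P x - P z))\<^sup>2 \<le> inner (P x - P z) (x - z)"
proof -
  have "P x \<in> S" "P z \<in> S" unfolding P_def using assms closest_point_in_set by blast+
  then have "inner (x - P x) (P z - P x) \<le> 0" "inner (z - P z) (P x - P z) \<le> 0"
    unfolding P_def using closest_point_dot assms(1,2) by blast+
  then show ?thesis
    by (simp add: power2_norm_eq_inner inner_diff_left inner_diff_right inner_commute)
qed

lemma closest_point_subspace_orthogonal:
  fixes L :: "'a::euclidean_space set"
  assumes "subspace L" "v \<in> L"
  shows "inner v (x - closest_point L x) = 0"
proof -
  have cl: "closed L" "convex L" "L \<noteq> {}"
    using assms closed_subspace subspace_imp_convex by auto
  have "closest_point L x \<in> L" using cl closest_point_in_set by blast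
  then have "closest_point L x + v \<in> L" "closest_point L x - v \<in> L"
    using assms subspace_add subspace_diff by blast+
  from this[THEN closest_point_dot[OF cl(2,1), of _ x]] show ?thesis
    by (simp add: inner_commute)
qed

text \<open>
  The pointwise core. Both displacements lie in \<open>L\<close>, so they see only the \<open>L\<close>-component \<open>e\<close> of
  \<open>x - z\<close>; by firm nonexpansiveness the displacement \<open>d\<close> in \<open>S\<close> cannot have a larger inner product
  with \<open>e\<close> than \<open>e\<close> itself.
\<close>

lemma closest_point_subspace_dominates:
  fixes L S :: "'a::euclidean_space set"
  assumes "subspace L" "S \<subseteq> L" "convex S" "closed S" "S \<noteq> {}"
  shows "inner (closest_point S x - closest_point S z) (x - z)
       \<le> inner (closest_point L x - closest_point L z) (x - z)"
proof -
  define d where "d = closest_point S x - closest_point S z"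
  define e where "e = closest_point L x - closest_point L z"
  have "closed L" "L \<noteq> {}" using assms closed_subspace by auto
  then have "d \<in> L" "e \<in> L"
    unfolding d_def e_def
    using assms closest_point_in_set[of S] closest_point_in_set[of L] subspace_diff
    by blast+
  then have orth: "inner v (x - z) = inner v e" if "v \<in> {d, e}" for v
    using that closest_point_subspace_orthogonal[OF assms(1), of v x]
      closest_point_subspace_orthogonal[OF assms(1), of v z]
    unfolding e_def by (auto simp: inner_diff_right)
  have "2 * inner d e \<le> (norm d)\<^sup>2 + (norm e)\<^sup>2"
    using inner_ge_zero[of "d - e"]
    by (simp add: power2_norm_eq_inner inner_diff_left inner_diff_right inner_commute)
  also have "(norm d)\<^sup>2 \<le> inner d e"
    using closest_point_firmly_nonexpansive[OF assms(3-5), of x z] orth[of d]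
    by (simp add: d_def)
  finally show ?thesis
    using orth by (simp add: d_def[symmetric] e_def[symmetric] power2_norm_eq_inner)
qed

section \<open>Square-integrable random vectors\<close>

lemma integrable_inner_square_integrable:
  fixes X Y :: "'a \<Rightarrow> 'b::euclidean_space"
  assumes [measurable]: "X \<in> borel_measurable M" "Y \<in> borel_measurable M"
    and "integrable M (\<lambda>w. (norm (X w))\<^sup>2)" "integrable M (\<lambda>w. (norm (Y w))\<^sup>2)"
  shows "integrable M (\<lambda>w. inner (X w) (Y w))"
proof (rule Bochner_Integration.integrable_bound)
  show "integrable M (\<lambda>w. (norm (X w))\<^sup>2 + (norm (Y w))\<^sup>2)" using assms by simp
  have "\<bar>inner a b\<bar> \<le> (norm a)\<^sup>2 + (norm b)\<^sup>2" for a b :: 'b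
    using Cauchy_Schwarz_ineq2[of a b] sum_squares_bound[of "norm a" "norm b"]
      mult_nonneg_nonneg[OF norm_ge_zero[of a] norm_ge_zero[of b]] by linarith
  then show "AE w in M. norm (inner (X w) (Y w)) \<le> norm ((norm (X w))\<^sup>2 + (norm (Y w))\<^sup>2)"
    by simp
qed simp

lemma (in finite_measure) integrable_of_square_integrable:
  fixes X :: "'a \<Rightarrow> 'b::euclidean_space"
  assumes "X \<in> borel_measurable M" and "integrable M (\<lambda>w. (norm (X w))\<^sup>2)"
  shows "integrable M X"
proof -
  have "integrable M (\<lambda>w. norm (X w))"
    using square_integrable_imp_integrable[of "\<lambda>w. norm (X w)"] assms by simp
  then show ?thesis using assms by (simp add: integrable_norm_iff)
qed

lemma (in prob_space) indep_var_integral_inner: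
  fixes X Y :: "'a \<Rightarrow> 'b::euclidean_space"
  assumes indep: "indep_var borel X borel Y" and X: "integrable M X" and Y: "integrable M Y"
  shows "expectation (\<lambda>w. inner (X w) (Y w)) = inner (expectation X) (expectation Y)"
proof -
  have b: "integrable M (\<lambda>w. inner (X w) b * inner (Y w) b)"
    "expectation (\<lambda>w. inner (X w) b * inner (Y w) b)
       = inner (expectation X) b * inner (expectation Y) b" for b
  proof -
    have "indep_var borel ((\<lambda>v. inner v b) \<circ> X) borel ((\<lambda>v. inner v b) \<circ> Y)"
      by (rule indep_var_compose[OF indep]) simp_all
    then have ind: "indep_var borel (\<lambda>w. inner (X w) b) borel (\<lambda>w. inner (Y w) b)"
      by (simp add: o_def)
    show "integrable M (\<lambda>w. inner (X w) b * inner (Y w) b)"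
      using indep_var_integrable[OF ind] X Y by simp
    show "expectation (\<lambda>w. inner (X w) b * inner (Y w) b)
       = inner (expectation X) b * inner (expectation Y) b"
      using indep_var_lebesgue_integral[OF ind] X Y by simp
  qed
  show ?thesis
    by (subst (1 2) euclidean_inner) (simp add: b Bochner_Integration.integral_sum)
qed

section \<open>Optimism as a covariance\<close>

text \<open>
  Expanding both squares leaves
  \<open>E \<parallel>ynew\<parallel>\<^sup>2 - E \<parallel>y\<parallel>\<^sup>2 = 0\<close> and
  \<open>2 (E \<langle>f(y), y\<rangle> - E \<langle>f(y), ynew\<rangle>)\<close>, and independence factors the last expectation. The constant
  \<open>c\<close> is free because \<open>y - E y\<close> is centred.
\<close>

lemma (in prob_space) optimism_eq_covariance:
  fixes y ynew :: "'a \<Rightarrow> real ^ 'n"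
  assumes copy: "independent_copy M y ynew"
    and y2: "integrable M (\<lambda>w. (norm (y w))\<^sup>2)"
    and f [measurable]: "f \<in> borel_measurable borel"
    and f2: "integrable M (\<lambda>w. (norm (f (y w)))\<^sup>2)"
  shows "optimism M y ynew f
    = 2 / real CARD('n) * expectation (\<lambda>w. inner (f (y w) - c) (y w - expectation y))"
proof -
  have indep: "indep_var borel y borel ynew" and d: "distr M borel ynew = distr M borel y"
    using copy by (auto simp: independent_copy_def)
  have [measurable]: "y \<in> borel_measurable M" "ynew \<in> borel_measurable M"
    using indep_var_rv1[OF indep] indep_var_rv2[OF indep] by auto
  have sq_new: "integrable M (\<lambda>w. (norm (ynew w))\<^sup>2)"
    using y2 integrable_distr_eq[of ynew M borel "\<lambda>v. (norm v)\<^sup>2"]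
      integrable_distr_eq[of y M borel "\<lambda>v. (norm v)\<^sup>2"] by (simp add: d)
  have E_sq_new: "expectation (\<lambda>w. (norm (ynew w))\<^sup>2) = expectation (\<lambda>w. (norm (y w))\<^sup>2)"
    using integral_distr[of ynew M borel "\<lambda>v. (norm v)\<^sup>2"]
      integral_distr[of y M borel "\<lambda>v. (norm v)\<^sup>2"] by (simp add: d)
  have E_new: "expectation ynew = expectation y"
  proof -
    have "expectation ynew = (\<integral>v. v \<partial>distr M borel ynew)"
      by (rule integral_distr[symmetric]) simp_all
    also have "\<dots> = expectation y"
      unfolding d by (rule integral_distr) simp_all
    finally show ?thesis .
  qed
  have int: "integrable M y" "integrable M ynew" "integrable M (\<lambda>w. f (y w))"
    using y2 sq_new f2 by (auto intro: integrable_of_square_integrable)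
  have inn: "integrable M (\<lambda>w. inner (f (y w)) (y w))"
    "integrable M (\<lambda>w. inner (f (y w)) (ynew w))"
    using y2 sq_new f2 by (auto intro: integrable_inner_square_integrable)
  have sq: "(norm (a - b))\<^sup>2 = (norm a)\<^sup>2 - 2 * inner a b + (norm b)\<^sup>2" for a b :: "real ^ 'n"
    by (simp add: power2_norm_eq_inner inner_diff_left inner_diff_right inner_commute)
  have "indep_var borel (f \<circ> y) borel (id \<circ> ynew)"
    by (rule indep_var_compose[OF indep]) auto
  then have "indep_var borel (\<lambda>w. f (y w)) borel ynew"
    by (simp add: o_def)
  then have fact: "expectation (\<lambda>w. inner (f (y w)) (ynew w))
      = inner (expectation (\<lambda>w. f (y w))) (expectation y)"
    using indep_var_integral_inner[of "\<lambda>w. f (y w)" ynew] int E_new by simp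
  have "optimism M y ynew f = 2 / real CARD('n) * (expectation (\<lambda>w. inner (f (y w)) (y w))
      - inner (expectation (\<lambda>w. f (y w))) (expectation y))"
    unfolding optimism_def sq using f2 y2 sq_new inn
    by (simp add: E_sq_new fact algebra_simps)
  also have "expectation (\<lambda>w. inner (f (y w)) (y w))
      - inner (expectation (\<lambda>w. f (y w))) (expectation y)
      = expectation (\<lambda>w. inner (f (y w) - c) (y w - expectation y))"
    using int inn by (simp add: inner_diff_left inner_diff_right prob_space)
  finally show ?thesis .
qed

section \<open>Second moments of a normal vector\<close>

text \<open>The integral of the square of one coordinate factors into one-dimensional normal moments.\<close>

lemma isotropic_normal_square_integrable:
  fixes y :: "'a \<Rightarrow> real ^ 'n"
  assumes "isotropic_normal M y \<mu> \<sigma>" "finite_measure M"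
  shows "integrable M (\<lambda>w. (norm (y w))\<^sup>2)"
proof -
  interpret finite_measure M by fact
  let ?\<phi> = "\<lambda>b t. normal_density (\<mu> \<bullet> b) \<sigma> t"
  have \<sigma>: "0 < \<sigma>"
    and D: "distributed M lborel y (\<lambda>x. ennreal (\<Prod>i\<in>UNIV. normal_density (\<mu> $ i) \<sigma> (x $ i)))"
    using assms unfolding isotropic_normal_def by auto
  have [measurable]: "y \<in> borel_measurable M" using distributed_measurable[OF D] by simp
  have dens: "(\<Prod>i\<in>UNIV. normal_density (\<mu> $ i) \<sigma> (x $ i)) = (\<Prod>b\<in>Basis. ?\<phi> b (x \<bullet> b))"
    for x :: "real ^ 'n"
  proof -
    have "(\<Prod>b\<in>Basis. ?\<phi> b (x \<bullet> b)) = (\<Prod>i\<in>UNIV. normal_density (\<mu> $ i) \<sigma> (x $ i))"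
      by (rule prod.reindex_cong[where l = "\<lambda>i. axis i 1"])
        (auto simp: inj_def axis_eq_axis Basis_vec_def inner_axis)
    then show ?thesis by simp
  qed
  have coord: "integrable M (\<lambda>w. (y w \<bullet> k - \<mu> \<bullet> k)\<^sup>2)" if k: "k \<in> Basis" for k
  proof (rule integrableI_nonneg)
    \<comment> \<open>Putting the weight of coordinate \<open>k\<close> into its own factor keeps the integrand a product.\<close>
    let ?g = "\<lambda>b t. ?\<phi> b t * (if b = k then (t - \<mu> \<bullet> b)\<^sup>2 else 1)"
    have g: "integrable lborel (?g b)" "0 \<le> ?g b t" for b t
      using integrable_normal_moment[OF \<sigma>, of "\<mu> \<bullet> b" 2] integrable_normal_density[OF \<sigma>]
      by (cases "b = k"; simp)+
    have "(\<integral>\<^sup>+w. ennreal ((y w \<bullet> k - \<mu> \<bullet> k)\<^sup>2) \<partial>M)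
        = (\<integral>\<^sup>+x. ennreal (\<Prod>b\<in>Basis. ?\<phi> b (x \<bullet> b)) * ennreal ((x \<bullet> k - \<mu> \<bullet> k)\<^sup>2) \<partial>lborel)"
      using distributed_nn_integral[OF D, of "\<lambda>x. ennreal ((x \<bullet> k - \<mu> \<bullet> k)\<^sup>2)"]
      by (simp add: dens)
    also have "\<dots> = (\<integral>\<^sup>+x. (\<Prod>b\<in>Basis. ennreal (?g b (x \<bullet> b))) \<partial>lborel)"
    proof (rule nn_integral_cong)
      fix x :: "real ^ 'n"
      have "(\<Prod>b\<in>Basis. ?g b (x \<bullet> b)) = (\<Prod>b\<in>Basis. ?\<phi> b (x \<bullet> b)) * (x \<bullet> k - \<mu> \<bullet> k)\<^sup>2"
        unfolding prod.distrib using k by (simp)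
      moreover have "(\<Prod>b\<in>Basis. ennreal (?g b (x \<bullet> b))) = ennreal (\<Prod>b\<in>Basis. ?g b (x \<bullet> b))"
        using g(2) by (intro prod_ennreal)
      ultimately show "ennreal (\<Prod>b\<in>Basis. ?\<phi> b (x \<bullet> b)) * ennreal ((x \<bullet> k - \<mu> \<bullet> k)\<^sup>2)
          = (\<Prod>b\<in>Basis. ennreal (?g b (x \<bullet> b)))"
        by (simp only: ennreal_mult prod_nonneg normal_density_nonneg zero_le_power2)
    qed
    also have "\<dots> = (\<Prod>b\<in>Basis. \<integral>\<^sup>+t. ennreal (?g b t) \<partial>lborel)"
      by (rule nn_integral_lborel_prod) auto
    also have "\<dots> = (\<Prod>b\<in>Basis. ennreal (\<integral>t. ?g b t \<partial>lborel))"
      using g by (intro prod.cong refl nn_integral_eq_integral) auto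
    also have "\<dots> < \<infinity>"
      using g by (simp add: prod_ennreal Bochner_Integration.integral_nonneg)
    finally show "(\<integral>\<^sup>+w. ennreal ((y w \<bullet> k - \<mu> \<bullet> k)\<^sup>2) \<partial>M) < \<infinity>" .
  qed auto
  have "integrable M (\<lambda>w. (norm (y w - \<mu>))\<^sup>2)"
    unfolding power2_norm_eq_inner
    by (subst euclidean_inner)
      (use coord in \<open>simp add: inner_diff_left power2_eq_square Bochner_Integration.integrable_sum\<close>)
  then have "integrable M (\<lambda>w. 2 * (norm (y w - \<mu>))\<^sup>2 + 2 * (norm \<mu>)\<^sup>2)" by simp
  then show ?thesis
  proof (rule Bochner_Integration.integrable_bound)
    have "(norm v)\<^sup>2 \<le> 2 * (norm (v - \<mu>))\<^sup>2 + 2 * (norm \<mu>)\<^sup>2" for v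
      \<comment> \<open>The difference of the two sides is \<open>\<parallel>v - 2\<mu>\<parallel>\<^sup>2\<close>.\<close>
      using inner_ge_zero[of "v - 2 *\<^sub>R \<mu>"]
      by (simp add: power2_norm_eq_inner inner_diff_left inner_diff_right inner_commute)
    then show "AE w in M. norm ((norm (y w))\<^sup>2) \<le> norm (2 * (norm (y w - \<mu>))\<^sup>2 + 2 * (norm \<mu>)\<^sup>2)"
      by (simp add: abs_of_nonneg)
  qed simp
qed

section \<open>Comparison of the optimisms\<close>

lemma (in finite_measure) closest_point_square_integrable:
  fixes y :: "'a \<Rightarrow> 'b::euclidean_space"
  assumes [measurable]: "y \<in> borel_measurable M"
    and y2: "integrable M (\<lambda>w. (norm (y w))\<^sup>2)"
    and S: "convex S" "closed S" "S \<noteq> {}"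
  shows "closest_point S \<in> borel_measurable borel"
    and "integrable M (\<lambda>w. (norm (closest_point S (y w)))\<^sup>2)"
proof -
  show [measurable]: "closest_point S \<in> borel_measurable borel"
    using continuous_on_closest_point[OF S] by (rule borel_measurable_continuous_onI)
  let ?c = "norm (closest_point S 0)"
  have "(norm (closest_point S v))\<^sup>2 \<le> 2 * ?c\<^sup>2 + 2 * (norm v)\<^sup>2" for v
  proof -
    have "norm (closest_point S v) \<le> ?c + norm v"
      using closest_point_lipschitz[OF S, of v 0]
        norm_triangle_sub[of "closest_point S v" "closest_point S 0"]
      by (simp add: dist_norm)
    then have "(norm (closest_point S v))\<^sup>2 \<le> (?c + norm v)\<^sup>2" by (simp add: power_mono)
    also have "\<dots> \<le> 2 * ?c\<^sup>2 + 2 * (norm v)\<^sup>2"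
      using sum_squares_bound[of ?c "norm v"] by (simp add: power2_sum)
    finally show ?thesis .
  qed
  then have "AE w in M. norm ((norm (closest_point S (y w)))\<^sup>2)
      \<le> norm (2 * ?c\<^sup>2 + 2 * (norm (y w))\<^sup>2)"
    by (simp add: abs_of_nonneg)
  then show "integrable M (\<lambda>w. (norm (closest_point S (y w)))\<^sup>2)"
    by (rule Bochner_Integration.integrable_bound[rotated -1]) (use y2 in simp_all)
qed

theorem theorem2:
  fixes L S :: "(real ^ 'n) set"
    and M :: "'a measure"
    and y ynew :: "'a \<Rightarrow> real ^ 'n"
    and \<mu> :: "real ^ 'n" and \<sigma> :: real
  assumes "subspace L"
    and "S \<subseteq> L"
    and "convex S"
    and "is_modeling_approach S"
    and "prob_space M"
    and "independent_copy M y ynew"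
    and "stein_conditions M y ynew \<mu> \<sigma> (fitted_model S)"
    and "stein_conditions M y ynew \<mu> \<sigma> (fitted_model L)"
  shows "optimism M y ynew (fitted_model S) \<le> optimism M y ynew (fitted_model L)"
proof -
  interpret prob_space M by fact
  have [measurable]: "y \<in> borel_measurable M"
    using assms(6) indep_var_rv1 unfolding independent_copy_def by blast
  have y2: "integrable M (\<lambda>w. (norm (y w))\<^sup>2)"
    using assms(7) finite_measure_axioms isotropic_normal_square_integrable
    unfolding stein_conditions_def by blast
  have S: "convex S" "closed S" "S \<noteq> {}"
    using assms(3) is_modeling_approach_closed[OF assms(4)] by auto
  have L: "convex L" "closed L" "L \<noteq> {}"
    using assms(1,2) S(3) by (auto simp: closed_subspace subspace_imp_convex)
  define m where "m = expectation y"
  let ?cov = "\<lambda>K w. inner (closest_point K (y w) - closest_point K m) (y w - m)"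
  have cov: "integrable M (?cov K)"
    "optimism M y ynew (fitted_model K) = 2 / real CARD('n) * expectation (?cov K)"
    if K: "convex K" "closed K" "K \<noteq> {}" for K
  proof -
    note P = closest_point_square_integrable[OF \<open>y \<in> borel_measurable M\<close> y2 K]
    have [measurable]: "closest_point K \<in> borel_measurable borel" by (rule P(1))
    have "integrable M y" "integrable M (\<lambda>w. closest_point K (y w))"
      "integrable M (\<lambda>w. inner (closest_point K (y w)) (y w))"
      using y2 P(2)
      by (auto intro: integrable_of_square_integrable integrable_inner_square_integrable)
    then show "integrable M (?cov K)"
      by (simp add: inner_diff_left inner_diff_right)
    show "optimism M y ynew (fitted_model K) = 2 / real CARD('n) * expectation (?cov K)"
      using optimism_eq_covariance[OF assms(6) y2 P] K
      unfolding m_def by (simp add: fitted_model_eq_closest_point)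
  qed
  have "expectation (?cov S) \<le> expectation (?cov L)"
    using cov(1)[OF S] cov(1)[OF L] closest_point_subspace_dominates[OF assms(1,2) S]
    by (intro integral_mono)
  then show ?thesis
    by (simp add: cov(2)[OF S] cov(2)[OF L] divide_right_mono)
qed

end
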